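(* Let $G$ be a locally finite, connected graph with at most countably many ends. Then for every finite set of vertices $A'$ of $G$ there is a finite set of vertices $A \supseteq A'$ such that every connected component of $G-A$ is boundary-linked.
   Context: A ray is a one-way infinite path. Two rays of $G$ are equivalent if there are infinitely many pairwise vertex-disjoint paths between them in $G$; an end of $G$ is an equivalence class of rays. For a set of vertices $B$, its boundary is the set of edges of $G$ with exactly one endvertex in $B$. A set of vertices $B$ (here, the vertex set of a component) is called boundary-linked if the subgraph consisting of the induced subgraph $G[B]$ together with the boundary edges of $B$ (and their endvertices) contains a collection of pairwise edge-disjoint, pairwise equivalent (in $G$) rays $R_1, R_2, \ldots$ such that each edge of the boundary of $B$ is the first edge of one of the rays $R_i$. *)

theory Defs
  imports Main "HOL-Library.Countable_Set"
begin

definition graph :: "'a set \<Rightarrow> ('a \<Rightarrow> 'a \<Rightarrow> bool) \<Rightarrow> bool" where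
  "graph V E \<longleftrightarrow> (\<forall>u v. E u v \<longrightarrow> E v u) \<and> (\<forall>u. \<not> E u u)
                 \<and> (\<forall>u v. E u v \<longrightarrow> u \<in> V \<and> v \<in> V)"

definition edges :: "('a \<Rightarrow> 'a \<Rightarrow> bool) \<Rightarrow> 'a set set" where
  "edges E = {{u, v} | u v. E u v}"

definition locally_finite :: "'a set \<Rightarrow> ('a \<Rightarrow> 'a \<Rightarrow> bool) \<Rightarrow> bool" where
  "locally_finite V E \<longleftrightarrow> (\<forall>v\<in>V. finite {u. E v u})"

definition reach_in :: "('a \<Rightarrow> 'a \<Rightarrow> bool) \<Rightarrow> 'a set \<Rightarrow> 'a \<Rightarrow> 'a \<Rightarrow> bool" where
  "reach_in E S u v \<longleftrightarrow> u \<in> S \<and> v \<in> S \<and> (\<lambda>x y. E x y \<and> x \<in> S \<and> y \<in> S)\<^sup>*\<^sup>* u v"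

definition connected_graph :: "'a set \<Rightarrow> ('a \<Rightarrow> 'a \<Rightarrow> bool) \<Rightarrow> bool" where
  "connected_graph V E \<longleftrightarrow> V \<noteq> {} \<and> (\<forall>u\<in>V. \<forall>v\<in>V. reach_in E V u v)"

definition is_path :: "'a set \<Rightarrow> ('a \<Rightarrow> 'a \<Rightarrow> bool) \<Rightarrow> 'a list \<Rightarrow> bool" where
  "is_path V E P \<longleftrightarrow> P \<noteq> [] \<and> distinct P \<and> set P \<subseteq> V
                    \<and> (\<forall>i. Suc i < length P \<longrightarrow> E (P ! i) (P ! Suc i))"

definition is_ray :: "'a set \<Rightarrow> ('a \<Rightarrow> 'a \<Rightarrow> bool) \<Rightarrow> (nat \<Rightarrow> 'a) \<Rightarrow> bool" where
  "is_ray V E R \<longleftrightarrow> inj R \<and> range R \<subseteq> V \<and> (\<forall>i. E (R i) (R (Suc i)))"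

definition ray_edges :: "(nat \<Rightarrow> 'a) \<Rightarrow> 'a set set" where
  "ray_edges R = {{R i, R (Suc i)} | i. True}"

definition first_edge :: "(nat \<Rightarrow> 'a) \<Rightarrow> 'a set" where
  "first_edge R = {R 0, R 1}"

definition ray_equiv :: "'a set \<Rightarrow> ('a \<Rightarrow> 'a \<Rightarrow> bool) \<Rightarrow> (nat \<Rightarrow> 'a) \<Rightarrow> (nat \<Rightarrow> 'a) \<Rightarrow> bool" where
  "ray_equiv V E R1 R2 \<longleftrightarrow>
     (\<exists>P :: nat \<Rightarrow> 'a list.
        (\<forall>n. is_path V E (P n) \<and> hd (P n) \<in> range R1 \<and> last (P n) \<in> range R2)
      \<and> (\<forall>m n. m \<noteq> n \<longrightarrow> set (P m) \<inter> set (P n) = {}))"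

definition ends :: "'a set \<Rightarrow> ('a \<Rightarrow> 'a \<Rightarrow> bool) \<Rightarrow> (nat \<Rightarrow> 'a) set set" where
  "ends V E = (\<lambda>R. {R'. is_ray V E R' \<and> ray_equiv V E R R'}) ` {R. is_ray V E R}"

definition component :: "'a set \<Rightarrow> ('a \<Rightarrow> 'a \<Rightarrow> bool) \<Rightarrow> 'a set \<Rightarrow> 'a set \<Rightarrow> bool" where
  "component V E A C \<longleftrightarrow> (\<exists>v \<in> V - A. C = {u. reach_in E (V - A) v u})"

definition boundary :: "('a \<Rightarrow> 'a \<Rightarrow> bool) \<Rightarrow> 'a set \<Rightarrow> 'a set set" where
  "boundary E B = {{u, v} | u v. E u v \<and> u \<in> B \<and> v \<notin> B}"

definition closure_edges :: "('a \<Rightarrow> 'a \<Rightarrow> bool) \<Rightarrow> 'a set \<Rightarrow> 'a set set" where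
  "closure_edges E B = {{u, v} | u v. E u v \<and> (u \<in> B \<or> v \<in> B)}"

definition boundary_linked :: "'a set \<Rightarrow> ('a \<Rightarrow> 'a \<Rightarrow> bool) \<Rightarrow> 'a set \<Rightarrow> bool" where
  "boundary_linked V E B \<longleftrightarrow>
     (\<exists>\<R> :: (nat \<Rightarrow> 'a) set.
        (\<forall>R\<in>\<R>. is_ray V E R \<and> ray_edges R \<subseteq> closure_edges E B)
      \<and> (\<forall>R\<in>\<R>. \<forall>R'\<in>\<R>. R \<noteq> R' \<longrightarrow> ray_edges R \<inter> ray_edges R' = {})
      \<and> (\<forall>R\<in>\<R>. \<forall>R'\<in>\<R>. ray_equiv V E R R')
      \<and> (\<forall>e\<in>boundary E B. \<exists>R\<in>\<R>. first_edge R = e))"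

end

theory Submission
  imports Defs
begin

text \<open>
  Call a region \<open>C\<close> with finite boundary tight for a ray \<open>\<rho>\<close> if it contains a tail of \<open>\<rho>\<close> and no
  subregion of finite boundary containing a tail of \<open>\<rho>\<close> has a smaller boundary. A tight region is
  connected, and it is boundary-linked: choose tight regions \<open>C = D\<^sub>0 \<supseteq> D\<^sub>1 \<supseteq> \<dots>\<close> with empty
  intersection. By max-flow min-cut some finite flow from outside \<open>D\<^sub>n\<close> to \<open>D\<^sub>n\<^sub>+\<^sub>1\<close> saturates the boundary
  of \<open>D\<^sub>n\<close>. The union of these flows lets no more into any vertex of \<open>C\<close> than out of it, so it
  contains edge-disjoint trails starting in the boundary edges of \<open>C\<close>; as they end up in every
  \<open>D\<^sub>n\<close>, erasing their loops gives equivalent rays.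

  Now go through representatives \<open>\<rho>\<^sub>0, \<rho>\<^sub>1, \<dots>\<close> of the countably many ends. Whenever \<open>\<rho>\<^sub>n\<close> has no tail
  in the regions chosen so far, choose a region tight for \<open>\<rho>\<^sub>n\<close> that avoids \<open>A'\<close> and the closed
  neighbourhoods of the earlier regions. If the regions left infinitely many vertices uncovered at
  every stage, Koenig's lemma would give a ray that finally avoids each of them, although its end
  lives in one. So after finitely many stages the uncovered vertices form a finite set \<open>A\<close>,
  and the components of \<open>G - A\<close> are the chosen regions.
\<close>

text \<open>For symmetric \<open>E\<close> this is the boundary of \<open>X\<close> with every edge
  directed inwards: one arc per edge, so its cardinality is the size of the cut, and flows get the
  orientation they need.\<close>

definition in_arcs :: "('a \<Rightarrow> 'a \<Rightarrow> bool) \<Rightarrow> 'a set \<Rightarrow> ('a \<times> 'a) set" where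
  "in_arcs E X = {(u, v). E u v \<and> u \<notin> X \<and> v \<in> X}"

text \<open>Build the path from its end; if the new start already lies on it, keep only the part
  from there on.\<close>

lemma rtranclp_distinct_path:
  assumes "r\<^sup>*\<^sup>* x y"
  shows "\<exists>xs. xs \<noteq> [] \<and> distinct xs \<and> hd xs = x \<and> last xs = y \<and> successively r xs"
  using assms
proof (induction rule: converse_rtranclp_induct)
  case base
  show ?case by (rule exI[of _ "[y]"]) auto
next
  case (step x z)
  then obtain xs where xs: "xs \<noteq> []" "distinct xs" "hd xs = z" "last xs = y" "successively r xs"
    by blast
  show ?case
  proof (cases "x \<in> set xs")
    case True
    then obtain ys zs where "xs = ys @ x # zs" by (meson split_list)
    with xs show ?thesis
      by (intro exI[of _ "x # zs"]) (auto simp: successively_append_iff)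
  next
    case False
    with xs step(1) show ?thesis
      by (intro exI[of _ "x # xs"]) (auto simp: successively_Cons)
  qed
qed

section \<open>Flows and augmenting paths\<close>

text \<open>Sum the conservation law over the vertices of \<open>S\<close>. As \<open>S\<close> may
  be infinite, the sum runs over the finite set \<open>T\<close> of those that meet an arc of
  \<open>F\<close>.\<close>

lemma card_heads_eq_card_tails:
  assumes "finite F"
    and bal: "\<And>v. v \<in> S \<Longrightarrow> card {u. (u, v) \<in> F} = card {w. (v, w) \<in> F}"
  shows "card {a \<in> F. snd a \<in> S} = card {a \<in> F. fst a \<in> S}"
proof -
  define T where "T = S \<inter> (fst ` F \<union> snd ` F)"
  have T: "finite T" "T \<subseteq> S" unfolding T_def using assms(1) by auto
  have h: "card {a \<in> F. snd a = v} = card {u. (u, v) \<in> F}" for v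
    by (rule bij_betw_same_card[of fst]) (force simp: bij_betw_def inj_on_def image_iff)
  have t: "card {a \<in> F. fst a = v} = card {w. (v, w) \<in> F}" for v
    by (rule bij_betw_same_card[of snd]) (force simp: bij_betw_def inj_on_def image_iff)
  have "{a \<in> F. snd a \<in> S} = (\<Union>v\<in>T. {a \<in> F. snd a = v})" unfolding T_def by auto
  then have "card {a \<in> F. snd a \<in> S} = (\<Sum>v\<in>T. card {a \<in> F. snd a = v})"
    using T assms(1) by (simp only:) (subst card_UN_disjoint, auto)
  moreover have "{a \<in> F. fst a \<in> S} = (\<Union>v\<in>T. {a \<in> F. fst a = v})" unfolding T_def by auto
  then have "card {a \<in> F. fst a \<in> S} = (\<Sum>v\<in>T. card {a \<in> F. fst a = v})"
    using T assms(1) by (simp only:) (subst card_UN_disjoint, auto)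
  moreover have "(\<Sum>v\<in>T. card {a \<in> F. snd a = v}) = (\<Sum>v\<in>T. card {a \<in> F. fst a = v})"
    using T bal by (intro sum.cong) (auto simp: h t)
  ultimately show ?thesis by simp
qed

text \<open>A unit-capacity flow as a set of arcs, without the conservation law, which is broken while
  a path is being augmented.\<close>

definition flow :: "('a \<Rightarrow> 'a \<Rightarrow> bool) \<Rightarrow> 'a set \<Rightarrow> 'a set \<Rightarrow> ('a \<times> 'a) set \<Rightarrow> bool" where
  "flow E D D' F \<longleftrightarrow> finite F \<and> F \<subseteq> {(u, v). E u v \<and> u \<notin> D' \<and> v \<in> D} \<and> (\<forall>(u, v)\<in>F. (v, u) \<notin> F)"

text \<open>One surplus unit sits at \<open>hd xs\<close>. Sending it over the first arc of the
  path, by cancelling the reverse arc or else by adding the arc itself, moves the surplus to the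
  next vertex; in \<open>D'\<close> conservation is not demanded. A cancelled arc has its tail in
  \<open>D\<close>, so no arc entering \<open>D\<close> is lost.\<close>

lemma push_excess:
  assumes "flow E D D' F" and "xs \<noteq> []" and "distinct xs" and "last xs \<in> D'"
    and "successively (\<lambda>x y. E x y \<and> x \<in> D - D' \<and> y \<in> D \<and> (x, y) \<notin> F) xs"
    and "\<And>v. v \<in> D - D' \<Longrightarrow>
      card {u. (u, v) \<in> F} = card {w. (v, w) \<in> F} + (if v = hd xs then 1 else 0)"
  shows "\<exists>F'. flow E D D' F' \<and> in_arcs E D \<inter> F \<subseteq> F' \<and>
    (\<forall>v \<in> D - D'. card {u. (u, v) \<in> F'} = card {w. (v, w) \<in> F'})"
  using assms
proof (induction xs arbitrary: F)
  case Nil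
  then show ?case by simp
next
  case (Cons x ys)
  show ?case
  proof (cases ys)
    case Nil
    with Cons.prems show ?thesis by (intro exI[of _ F]) auto
  next
    case (Cons y zs)
    note P = Cons.prems
    have xy: "E x y" "x \<in> D - D'" "y \<in> D" "(x, y) \<notin> F" "x \<noteq> y"
      using P Cons by auto
    have fin: "finite F" and sub: "F \<subseteq> {(u, v). E u v \<and> u \<notin> D' \<and> v \<in> D}"
      and anti: "\<And>u v. (u, v) \<in> F \<Longrightarrow> (v, u) \<notin> F"
      using P(1) by (auto simp: flow_def)
    define F1 where "F1 = (if (y, x) \<in> F then F - {(y, x)} else insert (x, y) F)"
    have fi: "finite {u. (u, v) \<in> F}" for v
      by (rule finite_subset[of _ "fst ` F"]) (use fin in force)+
    have fo: "finite {w. (v, w) \<in> F}" for v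
      by (rule finite_subset[of _ "snd ` F"]) (use fin in force)+
    have flow1: "flow E D D' F1"
      using fin sub anti xy by (auto simp: flow_def F1_def)
    have succ1: "successively (\<lambda>x y. E x y \<and> x \<in> D - D' \<and> y \<in> D \<and> (x, y) \<notin> F1) ys"
    proof (rule successively_mono)
      show "successively (\<lambda>x y. E x y \<and> x \<in> D - D' \<and> y \<in> D \<and> (x, y) \<notin> F) ys"
        using P Cons by simp
      show "E p q \<and> p \<in> D - D' \<and> q \<in> D \<and> (p, q) \<notin> F1"
        if "p \<in> set ys" "q \<in> set ys" "E p q \<and> p \<in> D - D' \<and> q \<in> D \<and> (p, q) \<notin> F" for p q
        using that P(3) by (auto simp: F1_def)
    qed
    have exc1: "card {u. (u, v) \<in> F1} = card {w. (v, w) \<in> F1} + (if v = hd ys then 1 else 0)"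
      if v: "v \<in> D - D'" for v
    proof (cases "(y, x) \<in> F")
      case True
      have i: "{u. (u, v) \<in> F1} = (if v = x then {u. (u, v) \<in> F} - {y} else {u. (u, v) \<in> F})"
        and o: "{w. (v, w) \<in> F1} = (if v = y then {w. (v, w) \<in> F} - {x} else {w. (v, w) \<in> F})"
        using True by (auto simp: F1_def)
      have "y \<in> {u. (u, x) \<in> F}" "x \<in> {w. (y, w) \<in> F}" using True by auto
      then have "card {u. (u, x) \<in> F} = Suc (card ({u. (u, x) \<in> F} - {y}))"
        "card {w. (y, w) \<in> F} = Suc (card ({w. (y, w) \<in> F} - {x}))"
        using fi fo by (metis card.remove)+
      then show ?thesis
        unfolding i o using P(6)[OF v] Cons xy by (auto split: if_splits)
    next
      case False
      have i: "{u. (u, v) \<in> F1} = (if v = y then insert x {u. (u, v) \<in> F} else {u. (u, v) \<in> F})"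
        and o: "{w. (v, w) \<in> F1} = (if v = x then insert y {w. (v, w) \<in> F} else {w. (v, w) \<in> F})"
        using False by (auto simp: F1_def)
      show ?thesis
        unfolding i o using P(6)[OF v] Cons xy fi fo by (auto split: if_splits)
    qed
    have "\<exists>F'. flow E D D' F' \<and> in_arcs E D \<inter> F1 \<subseteq> F' \<and>
      (\<forall>v \<in> D - D'. card {u. (u, v) \<in> F'} = card {w. (v, w) \<in> F'})"
      by (rule Cons.IH[OF flow1 _ _ _ succ1 exc1]) (use P Cons in auto)
    moreover have "in_arcs E D \<inter> F \<subseteq> in_arcs E D \<inter> F1"
      using xy by (auto simp: in_arcs_def F1_def)
    ultimately show ?thesis by blast
  qed
qed

text \<open>One Ford-Fulkerson step: inserting \<open>(a, b)\<close> creates a surplus at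
  \<open>b\<close>, which is pushed along a residual path into \<open>D'\<close>. Entering arcs in
  use stay in use, which is what the induction in \<open>saturating_flow\<close> needs.\<close>

lemma augment_flow:
  assumes sym: "\<And>u v. E u v \<Longrightarrow> E v u" and DD: "D' \<subseteq> D" and finD: "finite (in_arcs E D)"
    and cut: "\<And>X. D' \<subseteq> X \<Longrightarrow> X \<subseteq> D \<Longrightarrow> finite (in_arcs E X) \<Longrightarrow>
      card (in_arcs E D) \<le> card (in_arcs E X)"
    and F: "flow E D D' F"
    and bal: "\<And>v. v \<in> D - D' \<Longrightarrow> card {u. (u, v) \<in> F} = card {w. (v, w) \<in> F}"
    and ab: "(a, b) \<in> in_arcs E D" "(a, b) \<notin> F"
  shows "\<exists>F'. flow E D D' F' \<and> insert (a, b) (in_arcs E D \<inter> F) \<subseteq> F' \<and>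
    (\<forall>v \<in> D - D'. card {u. (u, v) \<in> F'} = card {w. (v, w) \<in> F'})"
proof -
  have fin: "finite F" and sub: "F \<subseteq> {(u, v). E u v \<and> u \<notin> D' \<and> v \<in> D}"
    and anti: "\<And>u v. (u, v) \<in> F \<Longrightarrow> (v, u) \<notin> F"
    using F by (auto simp: flow_def)
  have abD: "E a b" "a \<notin> D" "b \<in> D" using ab by (auto simp: in_arcs_def)
  \<comment> \<open>Residual arcs: any arc not in \<open>F\<close>, hence also the reverse of any
    arc in \<open>F\<close>. Their tails lie outside \<open>D'\<close>, so a residual walk stops
    once it reaches \<open>D'\<close>.\<close>
  define r where "r = (\<lambda>x y. E x y \<and> x \<in> D - D' \<and> y \<in> D \<and> (x, y) \<notin> F)"
  define S where "S = {y. r\<^sup>*\<^sup>* b y}"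
  have bS: "b \<in> S" by (simp add: S_def)
  have SD: "S \<subseteq> D"
  proof
    fix y assume "y \<in> S"
    then have "r\<^sup>*\<^sup>* b y" by (simp add: S_def)
    then show "y \<in> D" using abD by (cases rule: rtranclp.cases) (auto simp: r_def)
  qed
  have Sstep: "y \<in> S" if "x \<in> S" "r x y" for x y
    using that unfolding S_def by auto
  \<comment> \<open>otherwise the residual reach \<open>S\<close> of \<open>b\<close> can be cut off: \<open>D - S\<close> has a smaller boundary than \<open>D\<close>\<close>
  have "S \<inter> D' \<noteq> {}"
  proof
    assume SD': "S \<inter> D' = {}"
    define X where "X = D - S"
    define P where "P = {(u, v) \<in> F. u \<notin> S \<and> v \<in> S}"
    define Q where "Q = {(u, v) \<in> F. u \<in> S \<and> v \<notin> S}"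
    define J where "J = {(u, v) \<in> F. u \<in> S \<and> v \<in> S}"
    define A where "A = {(u, v) \<in> in_arcs E D. v \<in> S}"
    define B where "B = {(u, v) \<in> in_arcs E D. v \<in> X}"
    have finA: "finite A" "finite B"
      using finD by (auto simp: A_def B_def elim: finite_subset[rotated])
    have finP: "finite P" "finite Q" "finite J"
      using fin by (auto simp: P_def Q_def J_def elim: finite_subset[rotated])
    \<comment> \<open>Conservation holds throughout \<open>S\<close>, which lies in
      \<open>D - D'\<close>, so as many arcs of \<open>F\<close> enter \<open>S\<close> as leave
      it.\<close>
    have "card {a \<in> F. snd a \<in> S} = card {a \<in> F. fst a \<in> S}"
      using fin bal SD SD' by (intro card_heads_eq_card_tails) auto
    moreover have "{a \<in> F. snd a \<in> S} = J \<union> P" "{a \<in> F. fst a \<in> S} = J \<union> Q"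
      by (auto simp: J_def P_def Q_def)
    moreover have "J \<inter> P = {}" "J \<inter> Q = {}" by (auto simp: J_def P_def Q_def)
    ultimately have PQ: "card P = card Q" using finP by (simp add: card_Un_disjoint)
    \<comment> \<open>An arc of \<open>F\<close> from \<open>D\<close> into \<open>S\<close> could
      be reversed, which would put its tail into \<open>S\<close>. So every arc of \<open>P\<close>
      enters \<open>D\<close> from outside, and \<open>(a, b)\<close> is not among them; this makes
      the count strict.\<close>
    have "P \<subseteq> A - {(a, b)}"
    proof
      fix e assume "e \<in> P"
      then obtain u v where e: "e = (u, v)" "(u, v) \<in> F" "u \<notin> S" "v \<in> S" by (auto simp: P_def)
      have "u \<notin> D"
      proof
        assume "u \<in> D"
        then have "r v u" using e anti sub sym SD SD' by (auto simp: r_def)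
        with e Sstep show False by blast
      qed
      then show "e \<in> A - {(a, b)}" using e sub SD ab by (auto simp: A_def in_arcs_def)
    qed
    then have "card P \<le> card (A - {(a, b)})" using finA by (intro card_mono) auto
    also have "\<dots> < card A"
      using finA ab bS by (intro card_Diff1_less) (auto simp: A_def)
    finally have PA: "card P < card A" .
    \<comment> \<open>An arc from \<open>S\<close> to \<open>X\<close> must lie in \<open>F\<close>,
      since otherwise its head would be in the residual reach.\<close>
    have XBQ: "in_arcs E X \<subseteq> B \<union> Q"
    proof
      fix e assume "e \<in> in_arcs E X"
      then obtain u v where e: "e = (u, v)" "E u v" "u \<notin> X" "v \<in> D" "v \<notin> S"
        by (auto simp: in_arcs_def X_def)
      show "e \<in> B \<union> Q"
      proof (cases "u \<in> D")
        case True
        then have "u \<in> S" using e by (auto simp: X_def)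
        moreover have "(u, v) \<in> F"
        proof (rule ccontr)
          assume "(u, v) \<notin> F"
          then have "r u v" using e \<open>u \<in> S\<close> SD SD' by (auto simp: r_def)
          with e \<open>u \<in> S\<close> Sstep show False by blast
        qed
        ultimately show ?thesis using e by (auto simp: Q_def)
      next
        case False
        then show ?thesis using e by (auto simp: B_def in_arcs_def X_def)
      qed
    qed
    have "card (in_arcs E X) \<le> card B + card Q"
      using card_mono[OF _ XBQ] card_Un_le[of B Q] finA finP by simp
    also have "\<dots> < card B + card A" using PQ PA by simp
    also have "\<dots> = card (B \<union> A)"
      using finA by (subst card_Un_disjoint) (auto simp: A_def B_def X_def)
    also have "\<dots> \<le> card (in_arcs E D)"
      using finD by (intro card_mono) (auto simp: A_def B_def)
    finally have "card (in_arcs E X) < card (in_arcs E D)" .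
    moreover have "finite (in_arcs E X)"
      using XBQ finA finP by (meson finite_UnI finite_subset)
    ultimately show False using cut[of X] SD' DD by (auto simp: X_def)
  qed
  then obtain y where "r\<^sup>*\<^sup>* b y" "y \<in> D'" by (auto simp: S_def)
  then obtain xs where xs: "xs \<noteq> []" "distinct xs" "hd xs = b" "last xs \<in> D'" "successively r xs"
    using rtranclp_distinct_path[of r b y] by auto
  define F0 where "F0 = insert (a, b) F"
  have fi: "finite {u. (u, v) \<in> F}" for v
    by (rule finite_subset[of _ "fst ` F"]) (use fin in force)+
  have "\<exists>F'. flow E D D' F' \<and> in_arcs E D \<inter> F0 \<subseteq> F' \<and>
    (\<forall>v \<in> D - D'. card {u. (u, v) \<in> F'} = card {w. (v, w) \<in> F'})"
  proof (rule push_excess)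
    show "flow E D D' F0"
      using fin sub anti abD DD by (auto simp: flow_def F0_def)
    show "successively (\<lambda>x y. E x y \<and> x \<in> D - D' \<and> y \<in> D \<and> (x, y) \<notin> F0) xs"
      using xs(5) abD by (elim successively_mono) (auto simp: r_def F0_def)
    fix v assume v: "v \<in> D - D'"
    have "{u. (u, v) \<in> F0} = (if v = b then insert a {u. (u, v) \<in> F} else {u. (u, v) \<in> F})"
      and "{w. (v, w) \<in> F0} = {w. (v, w) \<in> F}"
      using v abD by (auto simp: F0_def)
    then show "card {u. (u, v) \<in> F0} = card {w. (v, w) \<in> F0} + (if v = hd xs then 1 else 0)"
      using bal[OF v] fi ab xs by auto
  qed (use xs in auto)
  then show ?thesis using ab by (auto simp: F0_def)
qed

text \<open>The max-flow min-cut theorem for a cut \<open>D\<close> that is smallest among those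
  between \<open>D'\<close> and \<open>D\<close>: the entering arcs are saturated one by one, each
  augmentation preserving the earlier ones.\<close>

lemma saturating_flow:
  assumes sym: "\<And>u v. E u v \<Longrightarrow> E v u" and DD: "D' \<subseteq> D" and finD: "finite (in_arcs E D)"
    and cut: "\<And>X. D' \<subseteq> X \<Longrightarrow> X \<subseteq> D \<Longrightarrow> finite (in_arcs E X) \<Longrightarrow>
      card (in_arcs E D) \<le> card (in_arcs E X)"
  shows "\<exists>F. flow E D D' F \<and> in_arcs E D \<subseteq> F \<and>
    (\<forall>v \<in> D - D'. card {u. (u, v) \<in> F} = card {w. (v, w) \<in> F})"
proof -
  have "\<exists>F. flow E D D' F \<and> B \<subseteq> F \<and> 
    (\<forall>v \<in> D - D'. card {u. (u, v) \<in> F} = card {w. (v, w) \<in> F})" if "B \<subseteq> in_arcs E D" for B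
    using finite_subset[OF that finD] that
  proof (induction B rule: finite_induct)
    case empty
    show ?case by (rule exI[of _ "{}"]) (auto simp: flow_def)
  next
    case (insert e B)
    obtain a b where e: "e = (a, b)" by fastforce
    obtain F where F: "flow E D D' F" "B \<subseteq> F"
      "\<forall>v \<in> D - D'. card {u. (u, v) \<in> F} = card {w. (v, w) \<in> F}"
      using insert by blast
    show ?case
    proof (cases "e \<in> F")
      case True
      with F show ?thesis by blast
    next
      case False
      then have "\<exists>F'. flow E D D' F' \<and> insert (a, b) (in_arcs E D \<inter> F) \<subseteq> F' \<and>
        (\<forall>v \<in> D - D'. card {u. (u, v) \<in> F'} = card {w. (v, w) \<in> F'})"
        using F insert.prems e by (intro augment_flow[OF sym DD finD cut F(1)]) auto
      then show ?thesis using F(2) insert.prems e by blast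
    qed
  qed
  then show ?thesis by blast
qed

section \<open>From flows to rays\<close>

text \<open>As \<open>x\<close> never returns to \<open>x 0\<close>, erasing loops leaves its first
  step intact. The bound \<open>j \<ge> i\<close> lets statements about the tails of
  \<open>x\<close> pass to the tails of \<open>R\<close>.\<close>

lemma loop_erasure:
  fixes x :: "nat \<Rightarrow> 'a"
  assumes fin: "\<And>v. finite {j. x j = v}" and start: "\<And>j. x j = x 0 \<Longrightarrow> j = 0"
  shows "\<exists>R. inj R \<and> R 0 = x 0 \<and> R 1 = x 1 \<and>
    (\<forall>i. \<exists>j\<ge>i. R i = x j \<and> R (Suc i) = x (Suc j))"
proof -
  \<comment> \<open>leave each vertex after its last visit\<close>
  define l where "l i = Max {j. x j = x i}" for i
  define idx where "idx = rec_nat 0 (\<lambda>_ i. Suc (l i))"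
  have idx: "idx 0 = 0" "idx (Suc n) = Suc (l (idx n))" for n by (simp_all add: idx_def)
  have l: "x (l i) = x i" for i
    using Max_in[OF fin[of "x i"]] by (auto simp: l_def)
  have lmax: "j \<le> l i" if "x j = x i" for i j
    using that fin by (auto simp: l_def)
  have ge: "n \<le> idx n" for n
  proof (induction n)
    case (Suc n)
    then show ?case using lmax[of "idx n" "idx n"] by (simp add: idx)
  qed (simp add: idx)
  have mono: "l (idx m) < idx n" if "m < n" for m n
    using that
  proof (induction n)
    case (Suc n)
    then show ?case using lmax[of "idx n" "idx n"] by (cases "m = n") (auto simp: idx)
  qed simp
  have "inj (\<lambda>n. x (idx n))"
  proof (rule linorder_injI)
    fix m n :: nat assume "m < n"
    then show "x (idx m) \<noteq> x (idx n)"
      using mono lmax[of "idx n" "idx m"] by fastforce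
  qed
  moreover have "l 0 = 0" using start l by blast
  moreover have "\<exists>j\<ge>i. x (idx i) = x j \<and> x (idx (Suc i)) = x (Suc j)" for i
    using ge[of i] lmax[of "idx i" "idx i"] l by (intro exI[of _ "l (idx i)"]) (auto simp: idx)
  ultimately show ?thesis
    by (intro exI[of _ "\<lambda>n. x (idx n)"]) (auto simp: idx)
qed

text \<open>At every vertex of \<open>C\<close>, match the incoming arcs injectively with outgoing
  ones and follow the matching from each arc entering \<open>C\<close>. The resulting trails repeat
  no arc and share none; by \<open>conv\<close> each of them finally stays in every
  \<open>D n\<close>, so it visits each vertex only finitely often and its loops can be
  erased.\<close>

lemma rays_from_flow:
  assumes sub: "\<And>u v. (u, v) \<in> F \<Longrightarrow> v \<in> C"
    and anti: "\<And>u v. (u, v) \<in> F \<Longrightarrow> (v, u) \<notin> F"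
    and sat: "in_arcs E C \<subseteq> F"
    and fi: "\<And>v. finite {u. (u, v) \<in> F}" and fo: "\<And>v. finite {w. (v, w) \<in> F}"
    and bal: "\<And>v. v \<in> C \<Longrightarrow> card {u. (u, v) \<in> F} \<le> card {w. (v, w) \<in> F}"
    and conv: "\<And>n. finite {(u, v) \<in> F. u \<notin> D n}" and out: "\<And>v. \<exists>n::nat. v \<notin> D n"
  shows "\<exists>R. (\<forall>e\<in>in_arcs E C. inj (R e) \<and> R e 0 = fst e \<and> R e 1 = snd e \<and>
      (\<forall>i. (R e i, R e (Suc i)) \<in> F) \<and> (\<forall>n. \<forall>\<^sub>F i in sequentially. R e i \<in> D n)) \<and>
    (\<forall>e\<in>in_arcs E C. \<forall>e'\<in>in_arcs E C. e \<noteq> e' \<longrightarrow> ray_edges (R e) \<inter> ray_edges (R e') = {})"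
proof -
  have "\<exists>f. \<forall>v\<in>C. f v ` {u. (u, v) \<in> F} \<subseteq> {w. (v, w) \<in> F} \<and> inj_on (f v) {u. (u, v) \<in> F}"
  proof (rule bchoice, rule ballI)
    fix v assume "v \<in> C"
    from card_le_inj[OF fi fo bal[OF this]]
    show "\<exists>g. g ` {u. (u, v) \<in> F} \<subseteq> {w. (v, w) \<in> F} \<and> inj_on g {u. (u, v) \<in> F}" .
  qed
  then obtain f where fC: "\<forall>v\<in>C. f v ` {u. (u, v) \<in> F} \<subseteq> {w. (v, w) \<in> F} \<and> inj_on (f v) {u. (u, v) \<in> F}"
    by (elim exE)
  have f: "(v, f v u) \<in> F" if "(u, v) \<in> F" for u v
    using bspec[OF fC sub[OF that]] that by auto
  have finj: "inj_on (f v) {u. (u, v) \<in> F}" if "v \<in> C" for v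
    using bspec[OF fC that] by auto
  \<comment> \<open>\<open>nxt\<close> is injective and its range misses the arcs entering \<open>C\<close>, so orbits of these never close up or meet\<close>
  define nxt where "nxt = (\<lambda>(u, v). (v, f v u))"
  define t where "t e n = (nxt ^^ n) e" for e n
  have t0: "t e 0 = e" and tS: "t e (Suc n) = nxt (t e n)" for e n by (simp_all add: t_def)
  have tF: "t e n \<in> F" if "e \<in> in_arcs E C" for e n
  proof (induction n)
    case 0
    with that sat show ?case by (auto simp: t0)
  next
    case (Suc n)
    then show ?case using f by (auto simp: tS nxt_def split: prod.splits)
  qed
  have ninj: "p = q" if "nxt p = nxt q" "p \<in> F" "q \<in> F" for p q
    using that finj sub by (auto simp: nxt_def inj_on_def split: prod.splits)
  have headC: "snd (t e n) \<in> C" if "e \<in> in_arcs E C" for e n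
    using tF[OF that, of n] sub by (metis prod.collapse)
  have chain: "fst (t e (Suc n)) = snd (t e n)" for e n
    by (simp add: tS nxt_def split: prod.splits)
  \<comment> \<open>Go back along both trails until one is at its first arc. That arc has its tail
    outside \<open>C\<close>, whereas all later arcs have their tails in \<open>C\<close>, so the
    other trail is at its first arc too.\<close>
  have tinj: "e = e' \<and> i = j" if "e \<in> in_arcs E C" "e' \<in> in_arcs E C" "t e i = t e' j" for e e' i j
    using that(3)
  proof (induction i arbitrary: j)
    case 0
    show ?case
    proof (cases j)
      case (Suc k)
      then have "fst e \<in> C" using 0 chain headC that(2) by (metis t0)
      with that(1) show ?thesis by (auto simp: in_arcs_def)
    qed (use 0 in \<open>auto simp: t0\<close>)
  next
    case (Suc i)
    show ?case
    proof (cases j)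
      case 0
      then have "fst e' \<in> C" using Suc.prems chain headC that(1) by (metis t0)
      with that(2) show ?thesis by (auto simp: in_arcs_def)
    next
      case (Suc k)
      then show ?thesis using Suc.prems Suc.IH[of k] ninj tF that by (simp add: tS)
    qed
  qed
  define x where "x e n = fst (t e n)" for e n
  have tx: "t e n = (x e n, x e (Suc n))" for e n
    by (simp add: x_def chain)
  have xn: "finite {j. x e j \<notin> D n}" if "e \<in> in_arcs E C" for e n
  proof (rule inj_on_finite[of "t e"])
    show "inj_on (t e) {j. x e j \<notin> D n}" using tinj[OF that that] by (auto simp: inj_on_def)
    show "t e ` {j. x e j \<notin> D n} \<subseteq> {(u, v) \<in> F. u \<notin> D n}"
      using tF[OF that] by (auto simp: tx)
  qed (rule conv)
  have xfin: "finite {j. x e j = v}" if "e \<in> in_arcs E C" for e v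
  proof -
    obtain n where "v \<notin> D n" using out by blast
    then show ?thesis by (intro finite_subset[OF _ xn[OF that, of n]]) auto
  qed
  have x0: "j = 0" if "e \<in> in_arcs E C" "x e j = x e 0" for e j
  proof (cases j)
    case (Suc k)
    then have "fst e \<in> C" using chain headC that by (metis x_def t0)
    with that(1) show ?thesis by (auto simp: in_arcs_def)
  qed
  have "\<forall>e\<in>in_arcs E C. \<exists>R. inj R \<and> R 0 = x e 0 \<and> R 1 = x e 1 \<and>
    (\<forall>i. \<exists>j\<ge>i. R i = x e j \<and> R (Suc i) = x e (Suc j))"
    by (intro ballI loop_erasure xfin x0)
  then obtain R where R: "\<And>e. e \<in> in_arcs E C \<Longrightarrow> inj (R e) \<and> R e 0 = x e 0 \<and> R e 1 = x e 1 \<and>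
    (\<forall>i. \<exists>j\<ge>i. R e i = x e j \<and> R e (Suc i) = x e (Suc j))"
    by (auto dest!: bchoice)
  have arc: "(R e i, R e (Suc i)) \<in> F" if e: "e \<in> in_arcs E C" for e i
  proof -
    obtain j where "R e i = x e j" "R e (Suc i) = x e (Suc j)" using R[OF e] by blast
    then show ?thesis using tF[OF e, of j] by (simp add: tx)
  qed
  have ev: "\<forall>\<^sub>F i in sequentially. R e i \<in> D n" if e: "e \<in> in_arcs E C" for e n
  proof -
    obtain N where "{j. x e j \<notin> D n} \<subseteq> {..<N}"
      using finite_nat_bounded[OF xn[OF e]] by blast
    then have N: "j < N" if "x e j \<notin> D n" for j
      using that by auto
    have "R e i \<in> D n" if "i \<ge> N" for i
    proof -
      obtain j where "j \<ge> i" "R e i = x e j" using R[OF e] by blast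
      then show ?thesis using N[of j] that by force
    qed
    then show ?thesis by (auto simp: eventually_sequentially)
  qed
  have disj: "ray_edges (R e) \<inter> ray_edges (R e') = {}"
    if e: "e \<in> in_arcs E C" "e' \<in> in_arcs E C" "e \<noteq> e'" for e e'
  proof (rule ccontr)
    assume "ray_edges (R e) \<inter> ray_edges (R e') \<noteq> {}"
    then obtain i i' where "{R e i, R e (Suc i)} = {R e' i', R e' (Suc i')}"
      by (auto simp: ray_edges_def)
    \<comment> \<open>\<open>F\<close> never contains both directions of an edge, so rays sharing an
      edge share an arc, and hence so do their trails.\<close>
    then have "(R e i, R e (Suc i)) = (R e' i', R e' (Suc i'))"
      using anti arc[OF e(1), of i] arc[OF e(2), of i'] by (auto simp: doubleton_eq_iff)
    moreover obtain j where "R e i = x e j" "R e (Suc i) = x e (Suc j)"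
      using R[OF e(1)] by blast
    moreover obtain j' where "R e' i' = x e' j'" "R e' (Suc i') = x e' (Suc j')"
      using R[OF e(2)] by blast
    ultimately have "t e j = t e' j'" by (simp add: tx)
    with tinj e show False by blast
  qed
  have x01: "x e 0 = fst e" "x e (Suc 0) = snd e" for e
    using tx[of e 0] unfolding t0 by (metis fst_conv, metis snd_conv)
  show ?thesis
    using R arc ev disj by (intro exI[of _ R]) (simp add: x01)
qed

section \<open>Equivalence of rays and finite cuts\<close>

text \<open>Choose the paths greedily, each avoiding the finite set \<open>X n\<close> of the
  vertices on the paths chosen before.\<close>

lemma ray_equivI:
  assumes "\<And>X. finite X \<Longrightarrow> \<exists>P. is_path V E P \<and> hd P \<in> range R \<and> last P \<in> range R' \<and> set P \<inter> X = {}"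
  shows "ray_equiv V E R R'"
proof -
  obtain p where p: "\<And>X. finite X \<Longrightarrow>
      is_path V E (p X) \<and> hd (p X) \<in> range R \<and> last (p X) \<in> range R' \<and> set (p X) \<inter> X = {}"
    using assms by metis
  define X where "X = rec_nat {} (\<lambda>_ X. X \<union> set (p X))"
  have X: "X 0 = {}" "X (Suc n) = X n \<union> set (p (X n))" for n by (simp_all add: X_def)
  have fin: "finite (X n)" for n by (induction n) (auto simp: X)
  have sub: "set (p (X m)) \<subseteq> X n" if "m < n" for m n
    using that by (induction n) (auto simp: X less_Suc_eq)
  have "set (p (X m)) \<inter> set (p (X n)) = {}" if "m \<noteq> n" for m n
    using that sub[of m n] sub[of n m] p[OF fin[of m]] p[OF fin[of n]]
    by (cases m n rule: linorder_cases) blast+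
  then show ?thesis
    unfolding ray_equiv_def using p fin by (intro exI[of _ "\<lambda>n. p (X n)"]) blast
qed

lemma is_path_iff_successively:
  "is_path V E P \<longleftrightarrow> P \<noteq> [] \<and> distinct P \<and> set P \<subseteq> V \<and> successively E P"
  by (auto simp: is_path_def successively_conv_nth)

lemma reach_in_path:
  assumes "reach_in E S x y" and "S \<subseteq> V"
  shows "\<exists>P. is_path V E P \<and> hd P = x \<and> last P = y \<and> set P \<subseteq> S"
proof -
  let ?r = "\<lambda>x y. E x y \<and> x \<in> S \<and> y \<in> S"
  obtain P where P: "P \<noteq> []" "distinct P" "hd P = x" "last P = y" "successively ?r P"
    using assms(1) rtranclp_distinct_path[of ?r x y] by (auto simp: reach_in_def)
  have "set P \<subseteq> S" using P assms(1)
  proof (cases P)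
    case (Cons a xs)
    have "x \<in> S" using assms(1) by (simp add: reach_in_def)
    have *: "successively ?r (b # ys) \<Longrightarrow> b \<in> S \<Longrightarrow> set (b # ys) \<subseteq> S" for b ys
      by (induction ys arbitrary: b) auto
    show ?thesis using * P Cons \<open>x \<in> S\<close> by fastforce
  qed simp
  moreover have "successively E P" using P(5) by (rule successively_mono) simp
  ultimately show ?thesis using P assms(2) by (auto simp: is_path_iff_successively)
qed

lemma eventually_notin_finite:
  assumes "inj R" and "finite B"
  shows "\<forall>\<^sub>F i in sequentially. R i \<notin> B"
  using finite_vimageI[OF assms(2,1)]
  by (simp add: cofinite_eq_sequentially[symmetric] eventually_cofinite vimage_def)

text \<open>An injective ray uses each arc into \<open>C\<close> at most once, so it enters
  \<open>C\<close> only finitely often; after the last entry, once it is outside it stays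
  outside.\<close>

lemma ray_eventually_in_or_out:
  assumes R: "is_ray V E R" and fin: "finite (in_arcs E C)"
  shows "(\<forall>\<^sub>F i in sequentially. R i \<in> C) \<or> (\<forall>\<^sub>F i in sequentially. R i \<notin> C)"
proof -
  have "finite {i. R i \<notin> C \<and> R (Suc i) \<in> C}"
    by (rule inj_on_finite[OF _ _ fin, of "\<lambda>i. (R i, R (Suc i))"])
      (use R in \<open>auto simp: is_ray_def inj_on_def in_arcs_def\<close>)
  then obtain N where "{i. R i \<notin> C \<and> R (Suc i) \<in> C} \<subseteq> {..<N}"
    using finite_nat_bounded by blast
  then have N: "i < N" if "R i \<notin> C" "R (Suc i) \<in> C" for i
    using that by auto
  show ?thesis
  proof (cases "\<exists>i\<ge>N. R i \<notin> C")
    case True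
    then obtain i where i: "i \<ge> N" "R i \<notin> C" by blast
    have "R j \<notin> C" if "j \<ge> i" for j
      using that by (induction j rule: dec_induct) (use i N in \<open>auto dest: N\<close>)
    then show ?thesis by (auto simp: eventually_sequentially)
  qed (auto simp: eventually_sequentially)
qed

text \<open>Of infinitely many disjoint paths between the rays, one misses the finite set
  \<open>Z\<close> made of the initial segments before \<open>N\<close> and \<open>N'\<close> and
  all ends of boundary edges. It runs from \<open>C\<close> to the outside of \<open>C\<close>
  without crossing the boundary.\<close>

lemma equivalent_rays_not_separated:
  assumes eq: "ray_equiv V E R R'" and sym: "\<And>u v. E u v \<Longrightarrow> E v u"
    and fin: "finite (in_arcs E C)"
    and R: "\<forall>\<^sub>F i in sequentially. R i \<in> C" and R': "\<forall>\<^sub>F i in sequentially. R' i \<notin> C"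
  shows False
proof -
  obtain P :: "nat \<Rightarrow> _" where P: "\<And>n. is_path V E (P n)" "\<And>n. hd (P n) \<in> range R" "\<And>n. last (P n) \<in> range R'"
    and disj: "\<And>m n. m \<noteq> n \<Longrightarrow> set (P m) \<inter> set (P n) = {}"
    using eq unfolding ray_equiv_def by metis
  obtain N where N: "\<And>i. i \<ge> N \<Longrightarrow> R i \<in> C" using R by (auto simp: eventually_sequentially)
  obtain N' where N': "\<And>i. i \<ge> N' \<Longrightarrow> R' i \<notin> C" using R' by (auto simp: eventually_sequentially)
  define Z where "Z = R ` {..<N} \<union> R' ` {..<N'} \<union> fst ` in_arcs E C \<union> snd ` in_arcs E C"
  have finZ: "finite Z" using fin by (simp add: Z_def)
  have "\<exists>n. set (P n) \<inter> Z = {}"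
  proof (rule ccontr)
    assume "\<nexists>n. set (P n) \<inter> Z = {}"
    then have "\<forall>n. \<exists>z. z \<in> set (P n) \<inter> Z" by blast
    then obtain z where z: "\<And>n. z n \<in> set (P n) \<inter> Z" by (metis (no_types))
    have "inj z"
    proof (rule injI)
      fix m n assume "z m = z n"
      then show "m = n" using z[of m] z[of n] disj[of m n] by auto
    qed
    moreover have "range z \<subseteq> Z" using z by auto
    ultimately show False using finZ by (meson finite_subset infinite_UNIV_nat range_inj_infinite)
  qed
  then obtain n where n: "set (P n) \<inter> Z = {}" by blast
  let ?P = "P n"
  have P0: "?P \<noteq> []" "successively E ?P" using P(1)[of n] by (auto simp: is_path_iff_successively)
  obtain i where i: "hd ?P = R i" using P(2) by blast
  have "R i \<notin> Z" using n hd_in_set[OF P0(1)] i by auto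
  then have hdC: "hd ?P \<in> C" using N[of i] i by (cases "i < N") (auto simp: Z_def)
  obtain i' where i': "last ?P = R' i'" using P(3) by blast
  have "R' i' \<notin> Z" using n last_in_set[OF P0(1)] i' by auto
  then have lastC: "last ?P \<notin> C" using N'[of i'] i' by (cases "i' < N'") (auto simp: Z_def)
  have "k < length ?P \<Longrightarrow> ?P ! k \<in> C" for k
  proof (induction k)
    case 0
    then show ?case using hdC P0 by (simp add: hd_conv_nth)
  next
    case (Suc k)
    show ?case
    proof (rule ccontr)
      assume "?P ! Suc k \<notin> C"
      moreover have "E (?P ! k) (?P ! Suc k)" using P0(2) Suc.prems by (auto simp: successively_conv_nth)
      ultimately have "(?P ! Suc k, ?P ! k) \<in> in_arcs E C" using sym Suc by (auto simp: in_arcs_def)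
      then have "?P ! k \<in> Z" by (force simp: Z_def)
      with n Suc.prems show False by (meson Suc_lessD disjoint_iff nth_mem)
    qed
  qed
  from this[of "length ?P - 1"] lastC P0(1) show False by (simp add: last_conv_nth)
qed

section \<open>Tight regions\<close>

text \<open>The balls around \<open>r\<close> exhaust \<open>V\<close> by finite sets. Removing them
  makes a sequence of regions shrink to nothing, and the first ball containing a vertex gives its
  distance from \<open>r\<close>.\<close>

primrec nball :: "('a \<Rightarrow> 'a \<Rightarrow> bool) \<Rightarrow> 'a \<Rightarrow> nat \<Rightarrow> 'a set" where
  "nball E r 0 = {r}"
| "nball E r (Suc n) = nball E r n \<union> {w. \<exists>v\<in>nball E r n. E v w}"

text \<open>Minimality is asked among subregions only. This is preserved under restricting the
  competitors, and it yields the cut condition of \<open>saturating_flow\<close> for every subregion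
  that contains a tail.\<close>

definition tight :: "('a \<Rightarrow> 'a \<Rightarrow> bool) \<Rightarrow> (nat \<Rightarrow> 'a) \<Rightarrow> 'a set \<Rightarrow> bool" where
  "tight E \<rho> C \<longleftrightarrow> finite (in_arcs E C) \<and> (\<forall>\<^sub>F i in sequentially. \<rho> i \<in> C) \<and>
    (\<forall>X\<subseteq>C. (\<forall>\<^sub>F i in sequentially. \<rho> i \<in> X) \<longrightarrow> finite (in_arcs E X) \<longrightarrow>
      card (in_arcs E C) \<le> card (in_arcs E X))"

lemma tight_exists:
  assumes "finite (in_arcs E W)" and "\<forall>\<^sub>F i in sequentially. \<rho> i \<in> W"
  shows "\<exists>C\<subseteq>W. tight E \<rho> C"
proof -
  let ?P = "\<lambda>X. X \<subseteq> W \<and> (\<forall>\<^sub>F i in sequentially. \<rho> i \<in> X) \<and> finite (in_arcs E X)"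
  obtain C where C: "?P C" "\<And>X. ?P X \<Longrightarrow> card (in_arcs E C) \<le> card (in_arcs E X)"
    using ex_has_least_nat[of ?P W "\<lambda>X. card (in_arcs E X)"] assms by blast
  then show ?thesis unfolding tight_def by (intro exI[of _ C]) blast
qed

locale lf_connected_graph =
  fixes V :: "'a set" and E :: "'a \<Rightarrow> 'a \<Rightarrow> bool"
  assumes graph: "graph V E" and lf: "locally_finite V E" and conn: "connected_graph V E"
begin

lemma sym: "E u v \<Longrightarrow> E v u"
  and in_V: "E u v \<Longrightarrow> u \<in> V" "E u v \<Longrightarrow> v \<in> V"
  using graph by (auto simp: graph_def)

lemma finite_neighbours: "finite {u. E v u}"
proof (cases "v \<in> V")
  case False
  then have "{u. E v u} = {}" using in_V by blast
  then show ?thesis by simp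
qed (use lf in \<open>simp add: locally_finite_def\<close>)

lemma finite_arcs_from: "finite B \<Longrightarrow> finite {(u, v). u \<in> B \<and> E u v}"
proof -
  assume "finite B"
  moreover have "{(u, v). u \<in> B \<and> E u v} = (SIGMA u:B. {v. E u v})" by auto
  ultimately show ?thesis using finite_neighbours by simp
qed

text \<open>An arc into \<open>D - B\<close> either enters \<open>D\<close> or starts in
  \<open>B\<close>, and by local finiteness only finitely many start in \<open>B\<close>.\<close>

lemma finite_in_arcs_Diff:
  assumes "finite (in_arcs E D)" and "finite B"
  shows "finite (in_arcs E (D - B))"
  by (rule finite_subset[OF _ finite_UnI[OF assms(1) finite_arcs_from[OF assms(2)]]])
    (auto simp: in_arcs_def)

lemma finite_nball: "finite (nball E r n)"
proof (induction n)
  case (Suc n)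
  have "{w. \<exists>v\<in>nball E r n. E v w} = (\<Union>v\<in>nball E r n. {w. E v w})" by auto
  then show ?case using Suc finite_neighbours by simp
qed simp

lemma nball_covers:
  assumes "r \<in> V" and "v \<in> V"
  shows "\<exists>n. v \<in> nball E r n"
proof -
  have "(\<lambda>x y. E x y \<and> x \<in> V \<and> y \<in> V)\<^sup>*\<^sup>* r v"
    using conn assms by (auto simp: connected_graph_def reach_in_def)
  then show ?thesis
  proof (induction rule: rtranclp_induct)
    case base
    have "r \<in> nball E r 0" by simp
    then show ?case by blast
  next
    case (step y z)
    then obtain n where "y \<in> nball E r n" by blast
    with step have "z \<in> nball E r (Suc n)" by auto
    then show ?case by blast
  qed
qed

text \<open>The part \<open>K\<close> of \<open>C\<close> reachable from the tail of
  \<open>\<rho>\<close> within \<open>C\<close> has its boundary inside that of \<open>C\<close>, so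
  by minimality the two boundaries agree. A vertex of \<open>C - K\<close> would then be cut off
  from \<open>K\<close> in the whole connected graph.\<close>

lemma tight_connected:
  assumes \<rho>: "is_ray V E \<rho>" and C: "tight E \<rho> C" "C \<subseteq> V" and xy: "x \<in> C" "y \<in> C"
  shows "reach_in E C x y"
proof -
  let ?r = "\<lambda>x y. E x y \<and> x \<in> C \<and> y \<in> C"
  obtain N where N: "\<And>i. i \<ge> N \<Longrightarrow> \<rho> i \<in> C"
    using C(1) by (auto simp: tight_def eventually_sequentially)
  define K where "K = {y. ?r\<^sup>*\<^sup>* (\<rho> N) y}"
  have Kstep: "v \<in> K" if "u \<in> K" "E u v" "v \<in> C" "u \<in> C" for u v
    using that by (auto simp: K_def intro: rtranclp.rtrancl_into_rtrancl)
  have KC: "K \<subseteq> C"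
  proof
    fix y assume "y \<in> K"
    then have "?r\<^sup>*\<^sup>* (\<rho> N) y" by (simp add: K_def)
    then show "y \<in> C" using N[of N] by (cases rule: rtranclp.cases) auto
  qed
  have "\<rho> i \<in> K" if "i \<ge> N" for i
    using that
  proof (induction i rule: dec_induct)
    case base
    then show ?case by (simp add: K_def)
  next
    case (step i)
    moreover have "E (\<rho> i) (\<rho> (Suc i))" using \<rho> by (simp add: is_ray_def)
    ultimately show ?case using N[of i] N[of "Suc i"] Kstep[of "\<rho> i" "\<rho> (Suc i)"] by simp
  qed
  then have evK: "\<forall>\<^sub>F i in sequentially. \<rho> i \<in> K" by (auto simp: eventually_sequentially)
  have sub: "in_arcs E K \<subseteq> in_arcs E C"
    using Kstep KC sym by (fastforce simp: in_arcs_def)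
  have finC: "finite (in_arcs E C)" using C by (simp add: tight_def)
  have "card (in_arcs E C) \<le> card (in_arcs E K)"
    using C(1) KC evK finite_subset[OF sub finC] by (simp add: tight_def)
  then have eq: "in_arcs E K = in_arcs E C"
    using card_seteq[OF finC sub] by simp
  have "C \<subseteq> K"
  proof
    fix y assume y: "y \<in> C"
    have "(\<lambda>x y. E x y \<and> x \<in> V \<and> y \<in> V)\<^sup>*\<^sup>* (\<rho> N) y"
      using conn y C(2) N[of N] by (auto simp: connected_graph_def reach_in_def)
    \<comment> \<open>A walk from \<open>\<rho> N\<close> cannot step into \<open>C - K\<close>:
      from \<open>K\<close> it would stay in \<open>K\<close>, and from outside \<open>C\<close> it
      would use a boundary arc of \<open>C\<close> that is not one of \<open>K\<close>.\<close>
    then have "y \<notin> C - K"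
    proof (induction rule: rtranclp_induct)
      case base
      then show ?case by (simp add: K_def)
    next
      case (step u v)
      show ?case
      proof
        assume v: "v \<in> C - K"
        then have "u \<notin> C" using step Kstep KC by blast
        then have "(u, v) \<in> in_arcs E C" using v step by (auto simp: in_arcs_def)
        then show False using v eq by (auto simp: in_arcs_def)
      qed
    qed
    with y show "y \<in> K" by blast
  qed
  then have "?r\<^sup>*\<^sup>* (\<rho> N) x" "?r\<^sup>*\<^sup>* (\<rho> N) y" using xy by (auto simp: K_def)
  moreover have "symp ?r\<^sup>*\<^sup>*" by (rule symp_rtranclp) (auto simp: symp_def sym)
  ultimately have "?r\<^sup>*\<^sup>* x y" by (meson rtranclp_trans sympD)
  with xy show ?thesis by (simp add: reach_in_def)
qed

text \<open>The regions decrease to the empty set, so some \<open>D n\<close> misses a given finite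
  set; being connected, it joins tails of the two rays.\<close>

lemma ray_equiv_if_eventually_in_connected:
  fixes D :: "nat \<Rightarrow> 'a set"
  assumes conn: "\<And>n x y. x \<in> D n \<Longrightarrow> y \<in> D n \<Longrightarrow> reach_in E (D n) x y"
    and DV: "\<And>n. D n \<subseteq> V" and anti: "antimono D" and out: "\<And>v. \<exists>n. v \<notin> D n"
    and R: "\<And>n. \<forall>\<^sub>F i in sequentially. R i \<in> D n"
    and R': "\<And>n. \<forall>\<^sub>F i in sequentially. R' i \<in> D n"
  shows "ray_equiv V E R R'"
proof (rule ray_equivI)
  fix X :: "'a set" assume "finite X"
  then have "\<exists>n. D n \<inter> X = {}"
  proof (induction X rule: finite_induct)
    case (insert v X)
    then obtain n m where "D n \<inter> X = {}" "v \<notin> D m" using out by blast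
    then have "D (max n m) \<inter> insert v X = {}"
      using antimonoD[OF anti, of n "max n m"] antimonoD[OF anti, of m "max n m"] by auto
    then show ?case by blast
  qed simp
  then obtain n where n: "D n \<inter> X = {}" by blast
  obtain i j where "R i \<in> D n" "R' j \<in> D n"
    using R[of n] R'[of n] by (auto simp: eventually_sequentially)
  then obtain P where "is_path V E P" "hd P = R i" "last P = R' j" "set P \<subseteq> D n"
    using reach_in_path[OF conn DV] by blast
  with n show "\<exists>P. is_path V E P \<and> hd P \<in> range R \<and> last P \<in> range R' \<and> set P \<inter> X = {}"
    by (intro exI[of _ P]) auto
qed

lemma tight_boundary_linked:
  assumes \<rho>: "is_ray V E \<rho>" and C: "tight E \<rho> C" "C \<subseteq> V"
  shows "boundary_linked V E C"
proof -
  obtain r where r: "r \<in> V" using conn by (auto simp: connected_graph_def)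
  \<comment> \<open>Removing the ball of radius \<open>n\<close> at step \<open>n\<close> makes the
    intersection empty. The clause for \<open>n = 0\<close> fixes the start at \<open>C\<close> in
    the dependent choice.\<close>
  have "\<exists>D. \<forall>n. (tight E \<rho> (D n) \<and> D n \<subseteq> V \<and> (n = 0 \<longrightarrow> D n = C)) \<and>
    D (Suc n) \<subseteq> D n - nball E r n"
  proof (rule dependent_nat_choice)
    show "\<exists>X. tight E \<rho> X \<and> X \<subseteq> V \<and> (0 = 0 \<longrightarrow> X = C)" using C by blast
    fix X and n :: nat assume X: "tight E \<rho> X \<and> X \<subseteq> V \<and> (n = 0 \<longrightarrow> X = C)"
    have "\<forall>\<^sub>F i in sequentially. \<rho> i \<notin> nball E r n"
      using \<rho> by (intro eventually_notin_finite finite_nball) (simp add: is_ray_def)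
    then have "\<forall>\<^sub>F i in sequentially. \<rho> i \<in> X - nball E r n"
      using X by (auto simp: tight_def elim: eventually_elim2)
    then obtain Y where "Y \<subseteq> X - nball E r n" "tight E \<rho> Y"
      using tight_exists[of E "X - nball E r n" \<rho>] X finite_in_arcs_Diff finite_nball
      by (auto simp: tight_def)
    with X show "\<exists>Y. (tight E \<rho> Y \<and> Y \<subseteq> V \<and> (Suc n = 0 \<longrightarrow> Y = C)) \<and> Y \<subseteq> X - nball E r n"
      by blast
  qed
  then obtain D where D: "\<And>n. tight E \<rho> (D n)" "\<And>n. D n \<subseteq> V" "D 0 = C"
    "\<And>n. D (Suc n) \<subseteq> D n - nball E r n"
    by blast
  have dec: "antimono D" 
  proof (rule antimonoI)
    show "D n \<subseteq> D m" if "m \<le> n" for m n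
      by (rule lift_Suc_antimono_le[of D, OF _ that]) (use D(4) in blast)
  qed
  have mono: "D n \<subseteq> D m" if "m \<le> n" for m n using antimonoD[OF dec that] .
  have out: "\<exists>n. v \<notin> D n" for v
  proof (cases "v \<in> V")
    case True
    then obtain n where "v \<in> nball E r n" using nball_covers r by blast
    then show ?thesis using D(4)[of n] by blast
  next
    case False
    then show ?thesis using D(2) by blast
  qed
  have finD: "finite (in_arcs E (D n))" for n using D(1) by (simp add: tight_def)
  have "\<exists>F. flow E (D n) (D (Suc n)) F \<and> in_arcs E (D n) \<subseteq> F \<and>
    (\<forall>v \<in> D n - D (Suc n). card {u. (u, v) \<in> F} = card {w. (v, w) \<in> F})" for n
  proof (rule saturating_flow[OF sym mono finD])
    fix X assume X: "D (Suc n) \<subseteq> X" "X \<subseteq> D n" "finite (in_arcs E X)"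
    have "\<forall>\<^sub>F i in sequentially. \<rho> i \<in> D (Suc n)" using D(1) by (simp add: tight_def)
    then have "\<forall>\<^sub>F i in sequentially. \<rho> i \<in> X" using X by (auto elim: eventually_mono)
    with X show "card (in_arcs E (D n)) \<le> card (in_arcs E X)"
      using D(1)[of n] by (simp add: tight_def)
  qed simp_all
  then obtain F where F: "\<And>n. flow E (D n) (D (Suc n)) (F n)"
    and sat: "\<And>n. in_arcs E (D n) \<subseteq> F n"
    and bal: "\<And>n v. v \<in> D n - D (Suc n) \<Longrightarrow> card {u. (u, v) \<in> F n} = card {w. (v, w) \<in> F n}"
    by metis
  have finF: "finite (F n)" for n using F by (simp add: flow_def)
  have arcF: "E u v" "u \<notin> D (Suc n)" "v \<in> D n" if "(u, v) \<in> F n" for u v n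
    using F[of n] that by (auto simp: flow_def)
  define U where "U = (\<Union>n. F n)"
  have arcU: "E u v" "v \<in> C" if "(u, v) \<in> U" for u v
    using that arcF(1,3) subsetD[OF mono[OF le0]] D(3) unfolding U_def by blast+
  have fi: "finite {u. (u, v) \<in> U}" for v
    by (rule finite_subset[OF _ finite_neighbours[of v]]) (use arcU sym in blast)
  have fo: "finite {w. (v, w) \<in> U}" for v
    by (rule finite_subset[OF _ finite_neighbours[of v]]) (use arcU in blast)
  \<comment> \<open>The vertex \<open>v\<close> is in \<open>D m\<close> as a head of
    \<open>F m\<close> and outside \<open>D (Suc n)\<close> as a tail of \<open>F n\<close>. Applied
    both ways, this puts opposite arcs into the same \<open>F n\<close>, which no flow
    permits.\<close>
  have le: "m \<le> n" if "(u, v) \<in> F m" "(v, u) \<in> F n" for u v m n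
    using arcF[OF that(1)] arcF[OF that(2)] mono[of "Suc n" m] by (meson not_less_eq_eq subsetD)
  have antiU: "(v, u) \<notin> U" if uv: "(u, v) \<in> U" for u v
  proof
    assume "(v, u) \<in> U"
    then obtain m n where mn: "(u, v) \<in> F m" "(v, u) \<in> F n" using uv by (auto simp: U_def)
    then have "m = n" using le le_antisym by blast
    with mn F[of n] show False by (auto simp: flow_def)
  qed
  have "\<exists>R. (\<forall>e\<in>in_arcs E C. inj (R e) \<and> R e 0 = fst e \<and> R e 1 = snd e \<and>
      (\<forall>i. (R e i, R e (Suc i)) \<in> U) \<and> (\<forall>n. \<forall>\<^sub>F i in sequentially. R e i \<in> D n)) \<and>
    (\<forall>e\<in>in_arcs E C. \<forall>e'\<in>in_arcs E C. e \<noteq> e' \<longrightarrow> ray_edges (R e) \<inter> ray_edges (R e') = {})"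
  proof (rule rays_from_flow)
    show "in_arcs E C \<subseteq> U" using sat[of 0] D(3) by (auto simp: U_def)
    show "card {u. (u, v) \<in> U} \<le> card {w. (v, w) \<in> U}" if v: "v \<in> C" for v
    proof -
      define k where "k = (LEAST n. v \<notin> D n)"
      have "v \<notin> D k" using out unfolding k_def by (rule LeastI_ex)
      moreover have k: "v \<in> D n" if "n < k" for n using that not_less_Least k_def by blast
      ultimately obtain n where n: "v \<in> D n" "v \<notin> D (Suc n)"
        using v D(3) by (cases k) auto
      \<comment> \<open>Here \<open>n\<close> is the layer with \<open>v\<close> in
        \<open>D n\<close> but not in \<open>D (Suc n)\<close>. An arc into \<open>v\<close> from an
        earlier flow starts outside \<open>D n\<close>, so it is a boundary arc of
        \<open>D n\<close> and lies in \<open>F n\<close> by saturation. Arcs leaving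
        \<open>v\<close> may also come from later flows, hence only an inequality.\<close>
      have "(u, v) \<in> F n" if "(u, v) \<in> F m" for u m
      proof -
        have "m \<le> n" using arcF(3)[OF that] n mono[of "Suc n" m] by (meson not_less_eq_eq subsetD)
        then consider "m = n" | "Suc m \<le> n" by linarith
        then show ?thesis
        proof cases
          case 2
          then have "(u, v) \<in> in_arcs E (D n)"
            using arcF[OF that] mono[of "Suc m" n] n by (auto simp: in_arcs_def)
          then show ?thesis using sat by blast
        qed (use that in simp)
      qed
      then have "{u. (u, v) \<in> U} = {u. (u, v) \<in> F n}" by (auto simp: U_def)
      also have "card \<dots> = card {w. (v, w) \<in> F n}" using bal n by blast
      also have "\<dots> \<le> card {w. (v, w) \<in> U}"
        using fo by (intro card_mono) (auto simp: U_def)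
      finally show ?thesis .
    qed
    show "finite {(u, v) \<in> U. u \<notin> D n}" for n
    proof (rule finite_subset)
      \<comment> \<open>All arcs of \<open>F m\<close> with \<open>m \<ge> n\<close> have their
        heads in \<open>D n\<close>; if the tail is outside, the arc belongs to the finite
        boundary.\<close>
      show "{(u, v) \<in> U. u \<notin> D n} \<subseteq> (\<Union>m<n. F m) \<union> in_arcs E (D n)"
      proof clarify
        fix u v assume uv: "(u, v) \<in> U" "u \<notin> D n" "(u, v) \<notin> in_arcs E (D n)"
        then obtain m where m: "(u, v) \<in> F m" by (auto simp: U_def)
        have "v \<notin> D n" using uv arcU by (auto simp: in_arcs_def)
        then have "m < n" using arcF(3)[OF m] mono[of n m] by (meson not_less subsetD)
        with m show "(u, v) \<in> (\<Union>m<n. F m)" by blast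
      qed
    qed (use finF finD in auto)
  qed (use arcU antiU fi fo out in auto)
  then obtain R where R: "\<And>e. e \<in> in_arcs E C \<Longrightarrow> inj (R e) \<and> R e 0 = fst e \<and> R e 1 = snd e \<and>
      (\<forall>i. (R e i, R e (Suc i)) \<in> U) \<and> (\<forall>n. \<forall>\<^sub>F i in sequentially. R e i \<in> D n)"
    and disj: "\<And>e e'. e \<in> in_arcs E C \<Longrightarrow> e' \<in> in_arcs E C \<Longrightarrow> e \<noteq> e' \<Longrightarrow>
      ray_edges (R e) \<inter> ray_edges (R e') = {}"
    by blast
  have RE: "E (R e i) (R e (Suc i))" "R e (Suc i) \<in> C" if "e \<in> in_arcs E C" for e i
    using R[OF that] arcU by blast+
  have ray: "is_ray V E (R e)" if "e \<in> in_arcs E C" for e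
    using R[OF that] RE[OF that] in_V by (auto simp: is_ray_def)
  have closure: "ray_edges (R e) \<subseteq> closure_edges E C" if "e \<in> in_arcs E C" for e
    using RE[OF that] by (auto simp: ray_edges_def closure_edges_def)
  have equiv: "ray_equiv V E (R e) (R e')" if "e \<in> in_arcs E C" "e' \<in> in_arcs E C" for e e'
    using tight_connected[OF \<rho> D(1,2)] D(2) dec out R[OF that(1)] R[OF that(2)]
    by (intro ray_equiv_if_eventually_in_connected[of D]) auto
  have first: "\<exists>R'\<in>R ` in_arcs E C. first_edge R' = b" if b: "b \<in> boundary E C" for b
  proof -
    obtain u v where uv: "b = {u, v}" "E u v" "u \<in> C" "v \<notin> C" using b by (auto simp: boundary_def)
    then have e: "(v, u) \<in> in_arcs E C" using sym by (auto simp: in_arcs_def)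
    have "first_edge (R (v, u)) = b" using R[OF e] uv by (auto simp: first_edge_def)
    with e show ?thesis by blast
  qed
  show ?thesis
    unfolding boundary_linked_def
  proof (intro exI[of _ "R ` in_arcs E C"] conjI ballI impI)
    fix R1 R2 assume R12: "R1 \<in> R ` in_arcs E C" "R2 \<in> R ` in_arcs E C" "R1 \<noteq> R2"
    then obtain e e' where e: "e \<in> in_arcs E C" "e' \<in> in_arcs E C" "R1 = R e" "R2 = R e'" by blast
    with R12 have "e \<noteq> e'" by auto
    then show "ray_edges R1 \<inter> ray_edges R2 = {}" using disj e by simp
  qed (use ray closure equiv first in \<open>auto simp: subset_iff\<close>)
qed

section \<open>Covering all but finitely many vertices\<close>

text \<open>The ray moves away from a root \<open>r\<close>, one distance layer per step, through
  vertices that have infinitely many descendants in every \<open>A m\<close>. Far out, a descending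
  path from the ray to \<open>A m\<close> cannot cross the finite boundary of \<open>C\<close>; so
  if \<open>A m\<close> misses \<open>C\<close>, the ray is outside \<open>C\<close> as
  well.\<close>

lemma geodesic_ray:
  fixes A :: "nat \<Rightarrow> 'a set"
  assumes inf: "\<And>m. infinite (A m)" and AV: "\<And>m. A m \<subseteq> V" and anti: "antimono A"
  shows "\<exists>R. is_ray V E R \<and>
    (\<forall>C m. finite (in_arcs E C) \<longrightarrow> A m \<inter> C = {} \<longrightarrow> (\<forall>\<^sub>F i in sequentially. R i \<notin> C))"
proof -
  obtain r where r: "r \<in> V" using conn by (auto simp: connected_graph_def)
  define lev where "lev v = (LEAST n. v \<in> nball E r n)" for v
  define T where "T = (\<lambda>x y. E x y \<and> lev y = Suc (lev x))"
  define desc where "desc x = {v. T\<^sup>*\<^sup>* x v}" for x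
  have root: "T\<^sup>*\<^sup>* r v" if "lev v = n" "v \<in> V" for n v
    using that
  proof (induction n arbitrary: v)
    case 0
    have "v \<in> nball E r (lev v)"
      using nball_covers[OF r \<open>v \<in> V\<close>] unfolding lev_def by (rule LeastI_ex)
    with 0 show ?case by simp
  next
    case (Suc n)
    have "v \<in> nball E r (lev v)"
      using nball_covers[OF r \<open>v \<in> V\<close>] unfolding lev_def by (rule LeastI_ex)
    moreover have new: "v \<notin> nball E r m" if "m \<le> n" for m
      using that Suc.prems not_less_Least[of m "\<lambda>n. v \<in> nball E r n"] by (simp add: lev_def)
    ultimately obtain u where u: "u \<in> nball E r n" "E u v"
      using Suc.prems by auto
    have "lev u \<le> n" using u unfolding lev_def by (intro Least_le)
    moreover have "n \<le> lev u"
    proof (rule ccontr)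
      assume "\<not> n \<le> lev u"
      moreover have "u \<in> nball E r (lev u)"
        using u(1) unfolding lev_def by (rule LeastI)
      then have "v \<in> nball E r (Suc (lev u))" using u by auto
      ultimately show False using new[of "Suc (lev u)"] by simp
    qed
    ultimately have "lev u = n" by simp
    then show ?case using Suc u in_V by (auto simp: T_def intro: rtranclp.rtrancl_into_rtrancl)
  qed
  \<comment> \<open>Koenig's lemma in the graph of edges leading away from \<open>r\<close>\<close>
  define good where "good x \<longleftrightarrow> (\<forall>m. infinite (desc x \<inter> A m))" for x
  have "\<exists>y. good y \<and> T x y" if x: "good x" for x
  proof (rule ccontr)
    assume neg: "\<nexists>y. good y \<and> T x y"
    have finT: "finite {y. T x y}"
      by (rule finite_subset[OF _ finite_neighbours[of x]]) (auto simp: T_def)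
    have "\<forall>y\<in>{y. T x y}. \<exists>m. finite (desc y \<inter> A m)" using neg by (auto simp: good_def)
    then obtain f where f: "\<And>y. T x y \<Longrightarrow> finite (desc y \<inter> A (f y))" by (metis mem_Collect_eq)
    \<comment> \<open>As \<open>A\<close> decreases, the largest of the finitely many indices
      \<open>f y\<close> serves all successors of \<open>x\<close>; the 0 keeps \<open>Max\<close>
      defined if there are none.\<close>
    define M where "M = Max (insert 0 (f ` {y. T x y}))"
    have "finite (desc y \<inter> A M)" if "T x y" for y
    proof -
      have "f y \<le> M" unfolding M_def using finT that by (intro Max_ge) auto
      then have "A M \<subseteq> A (f y)" using anti by (rule antimonoD[rotated])
      then show ?thesis using f[OF that] by (meson Int_mono finite_subset subset_refl)
    qed
    then have "finite (insert x (\<Union>y\<in>{y. T x y}. desc y \<inter> A M))"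
      using finT by (intro finite.insertI finite_UN_I) auto
    moreover have "desc x \<inter> A M \<subseteq> insert x (\<Union>y\<in>{y. T x y}. desc y \<inter> A M)"
      by (auto simp: desc_def elim: converse_rtranclpE)
    ultimately have "finite (desc x \<inter> A M)" by (rule rev_finite_subset)
    with x show False by (simp add: good_def)
  qed
  moreover have "V \<subseteq> desc r" using root by (auto simp: desc_def)
  then have "good r"
    using inf AV unfolding good_def by (metis Int_absorb1 subset_trans)
  ultimately obtain R where R: "\<And>n. good (R n)" "\<And>n. T (R n) (R (Suc n))"
    using dependent_nat_choice[of "\<lambda>_. good" "\<lambda>_. T"] by metis
  have levR: "lev (R n) = lev (R 0) + n" for n
    using R(2) by (induction n) (auto simp: T_def)
  have "inj R" by (rule injI) (metis levR add_left_cancel)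
  then have "is_ray V E R"
    using R(2) in_V by (auto simp: is_ray_def T_def)
  moreover have "\<forall>\<^sub>F i in sequentially. R i \<notin> C"
    if C: "finite (in_arcs E C)" "A m \<inter> C = {}" for C m
  proof -
    define M where "M = Max (insert 0 (lev ` (fst ` in_arcs E C \<union> snd ` in_arcs E C)))"
    have M: "lev u \<le> M" "lev v \<le> M" if "(u, v) \<in> in_arcs E C" for u v
      unfolding M_def using C that image_eqI[OF _ that, of _ fst] image_eqI[OF _ that, of _ snd]
      by (auto intro!: Max_ge)
    \<comment> \<open>beyond the boundary of \<open>C\<close> no descending path can change sides\<close>
    have side: "M < lev v \<and> (v \<in> C \<longleftrightarrow> x \<in> C)" if "T\<^sup>*\<^sup>* x v" "M < lev x" for x v
      using that
    proof (induction rule: rtranclp_induct)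
      case (step u v)
      then have "(u, v) \<notin> in_arcs E C" "(v, u) \<notin> in_arcs E C" using M by force+
      with step show ?case using sym by (auto simp: in_arcs_def T_def)
    qed simp
    let ?N = "Suc M"
    have lN: "M < lev (R ?N)" using levR[of ?N] by simp
    have "desc (R ?N) \<inter> A m \<noteq> {}" using R(1) unfolding good_def by (metis finite.emptyI)
    then obtain s where "T\<^sup>*\<^sup>* (R ?N) s" "s \<in> A m" by (auto simp: desc_def)
    then have "R ?N \<notin> C" using side lN C(2) by blast
    moreover have "T\<^sup>*\<^sup>* (R ?N) (R i)" if "i \<ge> ?N" for i
      using that
    proof (induction i rule: dec_induct)
      case (step i)
      then show ?case using R(2) by (meson rtranclp.rtrancl_into_rtrancl)
    qed simp
    ultimately show ?thesis using side lN unfolding eventually_sequentially by blast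
  qed
  ultimately show ?thesis by blast
qed

section \<open>Finite families of separated regions\<close>

text \<open>The last clause makes distinct members disjoint and non-adjacent, so that components of
  the graph on \<open>\<Union>\<C>\<close> are members of \<open>\<C>\<close>.\<close>

definition regions :: "'a set \<Rightarrow> 'a set set \<Rightarrow> bool" where
  "regions A' \<C> \<longleftrightarrow> finite \<C> \<and>
    (\<forall>C\<in>\<C>. C \<subseteq> V - A' \<and> finite (in_arcs E C) \<and> boundary_linked V E C \<and>
      (\<forall>x\<in>C. \<forall>y\<in>C. reach_in E C x y)) \<and>
    (\<forall>C\<in>\<C>. \<forall>C'\<in>\<C>. \<forall>x\<in>C. \<forall>y\<in>C'. x = y \<or> E x y \<longrightarrow> C = C')"

lemma regions_separated:
  assumes "regions A' \<C>" and "C \<in> \<C>" and "C' \<in> \<C>" and "x \<in> C" and "y \<in> C'"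
    and "x = y \<or> E x y"
  shows "C = C'"
proof -
  have "\<forall>C\<in>\<C>. \<forall>C'\<in>\<C>. \<forall>x\<in>C. \<forall>y\<in>C'. x = y \<or> E x y \<longrightarrow> C = C'"
    using assms(1) unfolding regions_def by (elim conjE)
  from this[rule_format, OF assms(2-6)] show ?thesis .
qed

lemma regions_extend:
  assumes \<C>: "regions A' \<C>" and A': "finite A'" and \<rho>: "is_ray V E \<rho>"
  shows "\<exists>\<C>'. regions A' \<C>' \<and> \<C> \<subseteq> \<C>' \<and> (\<exists>C\<in>\<C>'. \<forall>\<^sub>F i in sequentially. \<rho> i \<in> C)"
proof (cases "\<exists>C\<in>\<C>. \<forall>\<^sub>F i in sequentially. \<rho> i \<in> C")
  case True
  with \<C> show ?thesis by blast
next
  case False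
  have fin: "finite \<C>" "\<And>C. C \<in> \<C> \<Longrightarrow> finite (in_arcs E C)" using \<C> by (auto simp: regions_def)
  \<comment> \<open>Both ends of the boundary edges are deleted: the outer ends keep the new region
    from touching an old one, and the inner ends include every vertex of an old region that has a
    neighbour in \<open>W\<close>, which makes the boundary of \<open>W\<close> finite.\<close>
  define Z where "Z = A' \<union> (\<Union>C\<in>\<C>. fst ` in_arcs E C \<union> snd ` in_arcs E C)"
  define W where "W = V - (Z \<union> \<Union>\<C>)"
  have finZ: "finite Z" unfolding Z_def using fin A' by auto
  have "in_arcs E W \<subseteq> {(u, v). u \<in> Z \<and> E u v}"
  proof clarify
    fix u v assume uv: "(u, v) \<in> in_arcs E W"
    then have E: "E u v" and u: "u \<in> Z \<union> \<Union>\<C>" and v: "v \<notin> \<Union>\<C>"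
      using in_V by (auto simp: in_arcs_def W_def)
    show "u \<in> Z \<and> E u v"
    proof (cases "u \<in> Z")
      case False
      then obtain C where C: "C \<in> \<C>" "u \<in> C" using u by blast
      then have "(v, u) \<in> in_arcs E C" using E v sym by (auto simp: in_arcs_def)
      then have "u \<in> Z" using C by (force simp: Z_def)
      with False show ?thesis by simp
    qed (use E in simp)
  qed
  then have finW: "finite (in_arcs E W)"
    using finite_arcs_from[OF finZ] by (rule finite_subset)
  have "\<forall>C\<in>\<C>. \<forall>\<^sub>F i in sequentially. \<rho> i \<notin> C"
    using False ray_eventually_in_or_out[OF \<rho>] fin by blast
  then have "\<forall>\<^sub>F i in sequentially. \<forall>C\<in>\<C>. \<rho> i \<notin> C"
    using fin by (simp add: eventually_ball_finite_distrib)
  moreover have "\<forall>\<^sub>F i in sequentially. \<rho> i \<notin> Z"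
    using \<rho> finZ by (intro eventually_notin_finite) (simp_all add: is_ray_def)
  ultimately have "\<forall>\<^sub>F i in sequentially. \<rho> i \<in> W"
    by eventually_elim (use \<rho> in \<open>auto simp: W_def is_ray_def\<close>)
  then obtain C where C: "C \<subseteq> W" "tight E \<rho> C" using tight_exists[OF finW] by blast
  have CV: "C \<subseteq> V - A'" using C by (auto simp: W_def Z_def)
  have sep: "\<not> (x = y \<or> E x y)" if "x \<in> C" "y \<in> C'" "C' \<in> \<C>" for x y C'
  proof
    assume "x = y \<or> E x y"
    moreover have "x \<notin> C'" using that C by (auto simp: W_def)
    ultimately have "(x, y) \<in> in_arcs E C'" using that by (auto simp: in_arcs_def)
    then have "x \<in> Z" using that by (force simp: Z_def)
    with that C show False by (auto simp: W_def)
  qed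
  have "regions A' (insert C \<C>)"
    unfolding regions_def
  proof (intro conjI ballI impI)
    show "finite (insert C \<C>)" using fin by simp
  next
    fix B assume B: "B \<in> insert C \<C>"
    show "B \<subseteq> V - A'" "finite (in_arcs E B)" "boundary_linked V E B"
      using B \<C> CV C \<rho> tight_boundary_linked[of \<rho> C] by (auto simp: regions_def tight_def)
    show "reach_in E B x y" if "x \<in> B" "y \<in> B" for x y
    proof (cases "B = C")
      case True
      with that CV C show ?thesis using tight_connected[OF \<rho> C(2)] by blast
    next
      case False
      with that B \<C> show ?thesis unfolding regions_def by blast
    qed
  next
    fix B B' x y
    assume B: "B \<in> insert C \<C>" "B' \<in> insert C \<C>" "x \<in> B" "y \<in> B'" and xy: "x = y \<or> E x y"
    consider "B = C" "B' \<in> \<C>" | "B' = C" "B \<in> \<C>" | "B = C" "B' = C" | "B \<in> \<C>" "B' \<in> \<C>"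
      using B by blast
    then show "B = B'"
    proof cases
      case 1
      then show ?thesis using sep B xy by blast
    next
      case 2
      then show ?thesis using sep[of y x B] B xy sym by blast
    next
      case 4
      then show ?thesis using regions_separated[OF \<C>] B(3,4) xy by simp
    qed simp
  qed
  moreover have "\<forall>\<^sub>F i in sequentially. \<rho> i \<in> C" using C by (simp add: tight_def)
  ultimately show ?thesis by blast
qed

text \<open>A walk inside \<open>\<Union>\<C>\<close> cannot leave the member in which it starts,
  and that member is itself connected.\<close>

lemma component_of_regions:
  assumes \<C>: "regions A' \<C>" and K: "component V E (V - \<Union>\<C>) K"
  shows "K \<in> \<C>"
proof -
  have UV: "V - (V - \<Union>\<C>) = \<Union>\<C>" using \<C> by (auto simp: regions_def)
  obtain v where v: "v \<in> \<Union>\<C>" "K = {u. reach_in E (\<Union>\<C>) v u}"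
    using K by (auto simp: component_def UV)
  then obtain C where C: "C \<in> \<C>" "v \<in> C" by blast
  have "u \<in> C" if "reach_in E (\<Union>\<C>) v u" for u
  proof -
    have "(\<lambda>x y. E x y \<and> x \<in> \<Union>\<C> \<and> y \<in> \<Union>\<C>)\<^sup>*\<^sup>* v u" using that by (simp add: reach_in_def)
    then show ?thesis
    proof (induction rule: rtranclp_induct)
      case (step y z)
      then obtain C' where "C' \<in> \<C>" "z \<in> C'" by blast
      then have "C = C'" using regions_separated[OF \<C> C(1), of C' y z] step by simp
      with \<open>z \<in> C'\<close> show ?case by simp
    qed (rule C)
  qed
  moreover have "reach_in E (\<Union>\<C>) v u" if u: "u \<in> C" for u
  proof -
    have "reach_in E C v u" using u C \<C> unfolding regions_def by blast
    then have "(\<lambda>x y. E x y \<and> x \<in> C \<and> y \<in> C)\<^sup>*\<^sup>* v u" by (simp add: reach_in_def)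
    then have "(\<lambda>x y. E x y \<and> x \<in> \<Union>\<C> \<and> y \<in> \<Union>\<C>)\<^sup>*\<^sup>* v u"
      by (rule rtranclp_mono[THEN predicate2D, rotated]) (use C in blast)
    then show ?thesis using u C by (auto simp: reach_in_def)
  qed
  ultimately have "K = C" using v by blast
  with C show ?thesis by simp
qed

section \<open>Exhausting the ends\<close>

lemma ray_equiv_refl:
  assumes "is_ray V E R"
  shows "ray_equiv V E R R"
proof (rule ray_equivI)
  fix X :: "'a set" assume "finite X"
  then have "\<forall>\<^sub>F i in sequentially. R i \<notin> X"
    using assms by (intro eventually_notin_finite) (simp_all add: is_ray_def)
  then obtain i where "R i \<notin> X" by (auto simp: eventually_sequentially)
  with assms show "\<exists>P. is_path V E P \<and> hd P \<in> range R \<and> last P \<in> range R \<and> set P \<inter> X = {}"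
    by (intro exI[of _ "[R i]"]) (auto simp: is_path_def is_ray_def)
qed

text \<open>Enumerate the ends and choose a representative of each. If there are no ends, the terms
  of the sequence may be no rays at all; therefore \<open>is_ray V E (\<rho> n)\<close> is part of
  the conclusion.\<close>

lemma countable_ends_enumerate:
  assumes "countable (ends V E)"
  shows "\<exists>\<rho> :: nat \<Rightarrow> nat \<Rightarrow> 'a. \<forall>R. is_ray V E R \<longrightarrow> (\<exists>n. is_ray V E (\<rho> n) \<and> ray_equiv V E (\<rho> n) R)"
proof -
  let ?cls = "\<lambda>R. {R'. is_ray V E R' \<and> ray_equiv V E R R'}"
  have "\<forall>\<omega>\<in>ends V E. \<exists>R. is_ray V E R \<and> \<omega> = ?cls R" by (auto simp: ends_def)
  then obtain rep where rep: "\<And>\<omega>. \<omega> \<in> ends V E \<Longrightarrow> is_ray V E (rep \<omega>) \<and> \<omega> = ?cls (rep \<omega>)"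
    by (auto dest!: bchoice)
  have "\<exists>n. is_ray V E (rep (from_nat_into (ends V E) n)) \<and>
    ray_equiv V E (rep (from_nat_into (ends V E) n)) R" if R: "is_ray V E R" for R
  proof -
    have e: "?cls R \<in> ends V E" using R by (auto simp: ends_def)
    then obtain n where n: "from_nat_into (ends V E) n = ?cls R"
      using from_nat_into_surj[OF assms] by blast
    \<comment> \<open>By reflexivity \<open>R\<close> belongs to its own class, which is also the
      class of the chosen representative.\<close>
    have "R \<in> ?cls (rep (?cls R))" using rep[OF e] R ray_equiv_refl[OF R] by blast
    with rep[OF e] n show ?thesis by (intro exI[of _ n]) auto
  qed
  then show ?thesis by (intro exI[of _ "\<lambda>n. rep (from_nat_into (ends V E) n)"]) blast
qed

lemma finite_complement_regions:
  assumes ends: "countable (ends V E)" and A': "finite A'"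
  shows "\<exists>\<C>. regions A' \<C> \<and> finite (V - \<Union>\<C>)"
proof -
  obtain \<rho> :: "nat \<Rightarrow> nat \<Rightarrow> 'a"
    where \<rho>: "\<And>R. is_ray V E R \<Longrightarrow> \<exists>n. is_ray V E (\<rho> n) \<and> ray_equiv V E (\<rho> n) R"
    using countable_ends_enumerate[OF ends] by blast
  have "\<exists>S. \<forall>n. regions A' (S n) \<and> (S n \<subseteq> S (Suc n) \<and>
    (is_ray V E (\<rho> n) \<longrightarrow> (\<exists>C\<in>S (Suc n). \<forall>\<^sub>F i in sequentially. \<rho> n i \<in> C)))"
  proof (rule dependent_nat_choice)
    have "regions A' {}" by (simp add: regions_def)
    then show "\<exists>\<C>. regions A' \<C>" by blast
    fix \<C> n assume \<C>: "regions A' \<C>"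
    show "\<exists>\<C>'. regions A' \<C>' \<and> (\<C> \<subseteq> \<C>' \<and>
      (is_ray V E (\<rho> n) \<longrightarrow> (\<exists>C\<in>\<C>'. \<forall>\<^sub>F i in sequentially. \<rho> n i \<in> C)))"
    proof (cases "is_ray V E (\<rho> n)")
      case True
      then show ?thesis using regions_extend[OF \<C> A' True] by blast
    qed (use \<C> in blast)
  qed
  then obtain S where S: "\<And>n. regions A' (S n)" "\<And>n. S n \<subseteq> S (Suc n)"
    "\<And>n. is_ray V E (\<rho> n) \<Longrightarrow> \<exists>C\<in>S (Suc n). \<forall>\<^sub>F i in sequentially. \<rho> n i \<in> C"
    by blast
  have "\<exists>n. finite (V - \<Union>(S n))"
  proof (rule ccontr)
    assume "\<nexists>n. finite (V - \<Union>(S n))"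
    moreover have "antimono (\<lambda>n. V - \<Union>(S n))"
    proof (rule antimonoI)
      fix m n :: nat assume "m \<le> n"
      then have "S m \<subseteq> S n" by (rule lift_Suc_mono_le[of S, rotated]) (rule S(2))
      then show "V - \<Union>(S n) \<subseteq> V - \<Union>(S m)" by blast
    qed
    ultimately obtain R where R: "is_ray V E R"
      and out: "\<And>C m. finite (in_arcs E C) \<Longrightarrow> (V - \<Union>(S m)) \<inter> C = {} \<Longrightarrow>
        \<forall>\<^sub>F i in sequentially. R i \<notin> C"
      using geodesic_ray[of "\<lambda>n. V - \<Union>(S n)"] by (metis Diff_subset)
    obtain n where n: "is_ray V E (\<rho> n)" "ray_equiv V E (\<rho> n) R" using \<rho>[OF R] by blast
    obtain C where C: "C \<in> S (Suc n)" "\<forall>\<^sub>F i in sequentially. \<rho> n i \<in> C" using S(3)[OF n(1)] by blast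
    have fin: "finite (in_arcs E C)" using S(1) C(1) unfolding regions_def by blast
    \<comment> \<open>Stage \<open>Suc n\<close> already contains \<open>C\<close>, so the vertices
      uncovered at that stage miss \<open>C\<close>.\<close>
    have "\<forall>\<^sub>F i in sequentially. R i \<notin> C" using C(1) by (intro out[OF fin, of "Suc n"]) blast
    then show False using equivalent_rays_not_separated[OF n(2) _ fin C(2)] sym by blast
  qed
  with S(1) show ?thesis by blast
qed

end

theorem theorem2p2:
  fixes V :: "'a set" and E :: "'a \<Rightarrow> 'a \<Rightarrow> bool" and A' :: "'a set"
  assumes "graph V E" and "locally_finite V E" and "connected_graph V E"
    and "countable (ends V E)"
    and "A' \<subseteq> V" and "finite A'"
  shows "\<exists>A. A' \<subseteq> A \<and> A \<subseteq> V \<and> finite A \<and>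
           (\<forall>C. component V E A C \<longrightarrow> boundary_linked V E C)"
proof -
  interpret lf_connected_graph V E by unfold_locales (rule assms)+
  obtain \<C> where \<C>: "regions A' \<C>" "finite (V - \<Union>\<C>)"
    using finite_complement_regions assms(4,6) by blast
  show ?thesis
  proof (intro exI[of _ "V - \<Union>\<C>"] conjI allI impI)
    show "A' \<subseteq> V - \<Union>\<C>" using \<C>(1) assms(5) by (auto simp: regions_def)
    show "boundary_linked V E C" if "component V E (V - \<Union>\<C>) C" for C
      using component_of_regions[OF \<C>(1) that] \<C>(1) by (auto simp: regions_def)
  qed (use \<C>(2) in auto)
qed

end
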